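(* In the setting and notation described in the context, the gap sequence is non-increasing, that is $$\Delta_{k+1}\le\Delta_k\quad\text{for all }k\ge0,$$ regardless of the algorithmic state, if for all $k\ge0$ the following hold: $$\mathbf{y}_{k+1}=\frac1{Y_{k+1}}\bigl(A_k\gamma_{k+1}\mathbf{x}_k+a_{k+1}\gamma_k\mathbf{v}_k\bigr),\qquad Y_{k+1}=A_k\gamma_{k+1}+a_{k+1}\gamma_k,$$ and $$a_{k+1}\le\mathcal{E}(\gamma_k,A_k,L_{k+1}),\qquad \mathcal{E}(\gamma_k,A_k,L_{k+1})=\frac{\gamma_k+A_k\mu}{2(L_{k+1}-\mu_f)}\left(1+\sqrt{1+\frac{4(L_{k+1}-\mu_f)A_k\gamma_k}{(\gamma_k+A_k\mu)^2}}\right).$$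
   Context: $f:\mathbb{R}^n\to\mathbb{R}$ is convex and differentiable with Lipschitz gradient and strong convexity parameter $\mu_f\ge0$ ($f-\frac{\mu_f}{2}\|\cdot\|_2^2$ convex); $\Psi:\mathbb{R}^n\to\mathbb{R}\cup\{+\infty\}$ is convex, lower semicontinuous, not identically $+\infty$, with strong convexity parameter $\mu_\Psi\ge0$ ($\Psi-\frac{\mu_\Psi}{2}\|\cdot\|_2^2$ convex). $F=f+\Psi$, $\mu=\mu_f+\mu_\Psi$; a minimizer of $F$ is assumed to exist and $\mathbf{x}^*$ is a fixed one. $Q_{\lambda,\mathbf{y}}(\mathbf{x})=f(\mathbf{y})+\langle\nabla f(\mathbf{y}),\mathbf{x}-\mathbf{y}\rangle+\frac{\lambda}{2}\|\mathbf{x}-\mathbf{y}\|_2^2$, and $T_L(\mathbf{y})=\arg\min_{\mathbf{x}}(Q_{L,\mathbf{y}}(\mathbf{x})+\Psi(\mathbf{x}))$ for $L>0$. Sequences: $A_0\ge0$, $\gamma_0>0$, $\mathbf{v}_0=\mathbf{x}_0\in\mathbb{R}^n$; for $k\ge0$, given $a_{k+1}>0$, $L_{k+1}>0$ with $L_{k+1}>\mu_f$, $\mathbf{y}_{k+1}\in\mathbb{R}^n$ and a main iterate $\mathbf{x}_{k+1}$, $$\mathbf{z}_{k+1}=T_{L_{k+1}}(\mathbf{y}_{k+1}),\quad A_{k+1}=A_k+a_{k+1},\quad \gamma_{k+1}=\gamma_k+a_{k+1}\mu,$$ $$\mathbf{v}_{k+1}=\frac1{\gamma_{k+1}}\bigl(\gamma_k\mathbf{v}_k+a_{k+1}(L_{k+1}+\mu_\Psi)\mathbf{z}_{k+1}-a_{k+1}(L_{k+1}-\mu_f)\mathbf{y}_{k+1}\bigr).$$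 It is assumed throughout that for all $k\ge0$: $F(\mathbf{x}_{k+1})\le F(\mathbf{z}_{k+1})\le Q_{L_{k+1},\mathbf{y}_{k+1}}(\mathbf{z}_{k+1})+\Psi(\mathbf{z}_{k+1})$. The gap sequence is $\Delta_k=A_k(F(\mathbf{x}_k)-F(\mathbf{x}^* ))+\frac{\gamma_k}{2}\|\mathbf{v}_k-\mathbf{x}^*\|_2^2$, $k\ge0$. Conventions: $F(\mathbf{x}_0)<\infty$ if $A_0>0$; if $A_0=0$, any term multiplied by $A_0$ is read as $0$. *)

theory Defs
  imports "HOL-Analysis.Analysis"
begin

text \<open>
  Functions into \<open>\<real> \<union> {+\<infinity>}\<close> are rendered as \<^typ>\<open>ereal\<close>-valued functions that never take the
  value \<open>-\<infinity>\<close>; this side condition is stated where they are used.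
\<close>

text \<open>
  The analogue of \<^const>\<open>convex_on\<close> (on the whole space) for extended-real-valued functions.
  The inequality has its usual meaning only for functions that avoid \<open>-\<infinity>\<close>, where no sum
  \<open>\<infinity> + (-\<infinity>)\<close> arises; at \<open>u = 0\<close> or \<open>v = 0\<close> it is trivial because \<open>0 * \<infinity> = 0\<close>.
\<close>

definition convex_ext :: "('a::real_vector \<Rightarrow> ereal) \<Rightarrow> bool" where
  "convex_ext g \<longleftrightarrow>
    (\<forall>x y u v. 0 \<le> u \<and> 0 \<le> v \<and> u + v = 1 \<longrightarrow>
      g (u *\<^sub>R x + v *\<^sub>R y) \<le> ereal u * g x + ereal v * g y)"

text \<open>The filter \<^term>\<open>at x\<close> is punctured; the value at \<open>x\<close> itself contributes nothing to the condition.\<close>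

definition lower_semicontinuous :: "('a::topological_space \<Rightarrow> ereal) \<Rightarrow> bool" where
  "lower_semicontinuous g \<longleftrightarrow> (\<forall>x. g x \<le> Liminf (at x) g)"

definition objective :: "('a \<Rightarrow> real) \<Rightarrow> ('a \<Rightarrow> ereal) \<Rightarrow> 'a \<Rightarrow> ereal" where
  "objective f \<Psi> x = ereal (f x) + \<Psi> x"

definition quad_model ::
  "('a::real_inner \<Rightarrow> real) \<Rightarrow> ('a \<Rightarrow> 'a) \<Rightarrow> real \<Rightarrow> 'a \<Rightarrow> 'a \<Rightarrow> real" where
  "quad_model f gradf l y x = f y + gradf y \<bullet> (x - y) + l / 2 * (norm (x - y))\<^sup>2"

text \<open>
  The operator \<open>T\<^sub>L(y)\<close>, as the set of minimizers. For a convex, lower semicontinuous, proper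
  \<open>\<Psi>\<close> and \<open>L > 0\<close> it is a singleton, so \<open>z = T\<^sub>L(y)\<close> is membership in this set.
\<close>

definition prox_grad_step ::
  "('a::real_inner \<Rightarrow> real) \<Rightarrow> ('a \<Rightarrow> 'a) \<Rightarrow> ('a \<Rightarrow> ereal) \<Rightarrow> real \<Rightarrow> 'a \<Rightarrow> 'a set" where
  "prox_grad_step f gradf \<Psi> L y =
    {z. is_arg_min (\<lambda>x. ereal (quad_model f gradf L y x) + \<Psi> x) (\<lambda>_. True) z}"

text \<open>
  The gap is extended-real-valued since \<open>F (x 0)\<close> may be \<open>\<infinity>\<close> when \<open>A 0 = 0\<close>; in that case
  \<open>0 * \<infinity> = 0\<close> in \<^typ>\<open>ereal\<close> makes the term vanish.
\<close>

definition gap ::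
  "('a::real_inner \<Rightarrow> ereal) \<Rightarrow> 'a \<Rightarrow> (nat \<Rightarrow> real) \<Rightarrow> (nat \<Rightarrow> real) \<Rightarrow> (nat \<Rightarrow> 'a) \<Rightarrow> (nat \<Rightarrow> 'a) \<Rightarrow>
    nat \<Rightarrow> ereal" where
  "gap F xstar A \<gamma> x v k =
    ereal (A k) * (F (x k) - F xstar) + ereal (\<gamma> k / 2 * (norm (v k - xstar))\<^sup>2)"

definition weight_bound :: "real \<Rightarrow> real \<Rightarrow> real \<Rightarrow> real \<Rightarrow> real \<Rightarrow> real" where
  "weight_bound \<mu>f \<mu> \<gamma> A L =
    (\<gamma> + A * \<mu>) / (2 * (L - \<mu>f)) *
    (1 + sqrt (1 + 4 * (L - \<mu>f) * A * \<gamma> / (\<gamma> + A * \<mu>)\<^sup>2))"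

end

theory Submission
  imports Defs
begin

text \<open>
  Write \<open>m = L + \<mu>\<Psi>\<close> and \<open>l = L - \<mu>f\<close>, so that \<open>m - l = \<mu>\<close>. The model \<open>Q + \<Psi>\<close> that the step
  \<open>z\<close> minimizes is strongly convex with parameter \<open>m\<close>, and it exceeds \<open>F\<close> by at most
  \<open>l / 2 * |u - y|\<^sup>2\<close>. With the descent condition this bounds \<open>F\<close> below by a function with exact
  curvature \<open>\<mu>\<close>: for every point \<open>u\<close>,
  \<open>F u \<ge> F x\<^sub>+ + m / 2 * |u - z|\<^sup>2 - l / 2 * |u - y|\<^sup>2\<close> (lemma \<open>prox_grad_lower_bound\<close>).

  This bound is used at only two points: with weight \<open>a\<close> at the minimizer and with weight \<open>A\<close> at the
  current iterate. What then remains of the claim is an inequality between squared distances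
  (lemma \<open>estimate_centre_descent\<close>). The update of \<open>v\<close> makes all terms containing the minimizer
  cancel, since \<open>v\<^sub>+\<close> is the centre of the accumulated quadratics; the choice of \<open>y\<close> cancels the mixed
  products of \<open>z - y\<close> with \<open>x - y\<close> and \<open>v - y\<close>. A sum of squares is left, whose only coefficient of
  unclear sign is that of \<open>|z - y|\<^sup>2\<close>, a positive multiple of \<open>A\<^sub>+ * \<gamma>\<^sub>+ - a\<^sup>2 * m\<close>. Its
  nonnegativity is the quadratic inequality in \<open>a\<close> whose larger root is the weight bound (lemma
  \<open>weight_bound_quadratic\<close>).
\<close>

section \<open>Strong convexity\<close>

lemma norm_convex_combination:
  fixes z u :: "'a::real_inner"
  shows "(norm ((1 - t) *\<^sub>R z + t *\<^sub>R u))\<^sup>2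
    = (1 - t) * (norm z)\<^sup>2 + t * (norm u)\<^sup>2 - t * (1 - t) * (norm (u - z))\<^sup>2"
  by (simp add: power2_norm_eq_inner inner_simps inner_commute algebra_simps)

text \<open>
  On the line through \<open>y\<close> and \<open>u\<close>, the difference of \<open>f\<close> and the quadratic is a convex function of
  one real variable, which lies above its tangent at \<open>y\<close>.
\<close>

lemma strongly_convex_above_tangent:
  fixes f :: "'a::real_inner \<Rightarrow> real"
  assumes conv: "convex_on UNIV (\<lambda>p. f p - c / 2 * (norm p)\<^sup>2)"
    and grad: "GDERIV f y :> g"
  shows "f y + g \<bullet> (u - y) + c / 2 * (norm (u - y))\<^sup>2 \<le> f u"
proof -
  define h where "h p = f p - c / 2 * (norm p)\<^sup>2" for p
  define line where "line t = y + t *\<^sub>R (u - y)" for t :: real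
  have "convex_on UNIV (\<lambda>t. h (line t))"
  proof (rule convex_onI)
    fix t r s :: real assume "0 < t" "t < 1"
    have "line ((1 - t) *\<^sub>R r + t *\<^sub>R s) = (1 - t) *\<^sub>R line r + t *\<^sub>R line s"
      by (simp add: line_def algebra_simps)
    then show "h (line ((1 - t) *\<^sub>R r + t *\<^sub>R s)) \<le> (1 - t) * h (line r) + t * h (line s)"
      using convex_onD[OF conv, of t "line r" "line s"] \<open>0 < t\<close> \<open>t < 1\<close> by (simp add: h_def)
  qed simp
  moreover have "((\<lambda>t. h (line t)) has_real_derivative g \<bullet> (u - y) - c * (y \<bullet> (u - y))) (at 0 within UNIV)"
  proof -
    have line: "(line has_derivative (\<lambda>t. t *\<^sub>R (u - y))) (at 0)"
      unfolding line_def by (auto intro!: derivative_eq_intros)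
    have "(f has_derivative (\<lambda>d. g \<bullet> d)) (at (line 0))"
      using grad by (simp add: gderiv_def line_def inner_commute)
    from has_derivative_compose[OF line this]
    have "((\<lambda>t. f (line t)) has_derivative (\<lambda>t. g \<bullet> (t *\<^sub>R (u - y)))) (at 0)" .
    then have "((\<lambda>t. f (line t)) has_real_derivative g \<bullet> (u - y)) (at 0)"
      by (simp add: has_field_derivative_def mult.commute[of _ "g \<bullet> (u - y)"])
    moreover have "((\<lambda>t. (norm y)\<^sup>2 + 2 * t * (y \<bullet> (u - y)) + t\<^sup>2 * (norm (u - y))\<^sup>2)
        has_real_derivative 2 * (y \<bullet> (u - y))) (at 0)"
      by (auto intro!: derivative_eq_intros)
    moreover have "(norm (line t))\<^sup>2 = (norm y)\<^sup>2 + 2 * t * (y \<bullet> (u - y)) + t\<^sup>2 * (norm (u - y))\<^sup>2" for t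
      unfolding line_def power2_norm_eq_inner
      by (simp add: inner_simps inner_commute power2_eq_square algebra_simps)
    ultimately show ?thesis
      unfolding h_def by (auto intro!: derivative_eq_intros)
  qed
  ultimately have "h (line 1) - h (line 0) \<ge> (g \<bullet> (u - y) - c * (y \<bullet> (u - y))) * (1 - 0)"
    by (intro convex_on_imp_above_tangent[where A = UNIV]) auto
  then have "f y + g \<bullet> (u - y) - c * (y \<bullet> (u - y)) + c / 2 * ((norm u)\<^sup>2 - (norm y)\<^sup>2) \<le> f u"
    by (simp add: h_def line_def algebra_simps)
  moreover have "c / 2 * (norm (u - y))\<^sup>2 = c / 2 * ((norm u)\<^sup>2 - (norm y)\<^sup>2) - c * (y \<bullet> (u - y))"
    by (simp add: power2_norm_eq_inner inner_simps inner_commute algebra_simps)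
  ultimately show ?thesis by linarith
qed

lemma convex_ext_strongD:
  fixes \<Psi> :: "'a::real_inner \<Rightarrow> ereal"
  assumes conv: "convex_ext (\<lambda>p. \<Psi> p - ereal (c / 2 * (norm p)\<^sup>2))"
    and "\<Psi> z = ereal p" "\<Psi> u = ereal q" "0 \<le> t" "t \<le> 1"
  shows "\<Psi> ((1 - t) *\<^sub>R z + t *\<^sub>R u)
    \<le> ereal ((1 - t) * p + t * q - c / 2 * (t * (1 - t) * (norm (u - z))\<^sup>2))"
proof -
  let ?w = "(1 - t) *\<^sub>R z + t *\<^sub>R u"
  have "\<Psi> ?w - ereal (c / 2 * (norm ?w)\<^sup>2)
      \<le> ereal (1 - t) * (\<Psi> z - ereal (c / 2 * (norm z)\<^sup>2)) + ereal t * (\<Psi> u - ereal (c / 2 * (norm u)\<^sup>2))"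
    using conv \<open>0 \<le> t\<close> \<open>t \<le> 1\<close> unfolding convex_ext_def by simp
  then show ?thesis
    unfolding norm_convex_combination using assms(2,3)
    by (cases "\<Psi> ?w") (auto simp: field_simps)
qed

section \<open>The proximal gradient step\<close>

lemma quad_model_convex_combination:
  "quad_model f gradf l y ((1 - t) *\<^sub>R z + t *\<^sub>R u)
    = (1 - t) * quad_model f gradf l y z + t * quad_model f gradf l y u
      - l / 2 * (t * (1 - t) * (norm (u - z))\<^sup>2)"
proof -
  have shift: "(1 - t) *\<^sub>R z + t *\<^sub>R u - y = (1 - t) *\<^sub>R (z - y) + t *\<^sub>R (u - y)"
    by (simp add: algebra_simps)
  show ?thesis
    unfolding quad_model_def shift norm_convex_combination
    by (simp add: inner_simps field_simps)
qed

lemma prox_grad_step_le: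
  assumes "z \<in> prox_grad_step f gradf \<Psi> l y"
  shows "ereal (quad_model f gradf l y z) + \<Psi> z \<le> ereal (quad_model f gradf l y u) + \<Psi> u"
  using assms by (auto simp: prox_grad_step_def is_arg_min_def not_less)

lemma prox_grad_step_finite:
  assumes "z \<in> prox_grad_step f gradf \<Psi> l y" and "\<Psi> u \<noteq> \<infinity>"
  shows "\<Psi> z \<noteq> \<infinity>"
  using prox_grad_step_le[OF assms(1), of u] assms(2) by (cases "\<Psi> u") auto

text \<open>
  Moving from the minimizer \<open>z\<close> a fraction \<open>t\<close> of the way towards \<open>u\<close> does not decrease the model.
  Strong convexity turns this into growth with the factor \<open>1 - t\<close>, and \<open>t\<close> tends to \<open>0\<close>.
\<close>

lemma prox_grad_step_growth:
  fixes \<Psi> :: "'a::real_inner \<Rightarrow> ereal"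
  assumes conv: "convex_ext (\<lambda>p. \<Psi> p - ereal (c / 2 * (norm p)\<^sup>2))"
    and step: "z \<in> prox_grad_step f gradf \<Psi> l y"
    and vals: "\<Psi> z = ereal p" "\<Psi> u = ereal q"
  shows "quad_model f gradf l y z + p + (l + c) / 2 * (norm (u - z))\<^sup>2
    \<le> quad_model f gradf l y u + q"
proof -
  let ?Q = "quad_model f gradf l y"
  let ?D = "(l + c) / 2 * (norm (u - z))\<^sup>2"
  have growth: "?Q z + p + (1 - t) * ?D \<le> ?Q u + q" if t: "0 < t" "t < 1" for t
  proof -
    let ?w = "(1 - t) *\<^sub>R z + t *\<^sub>R u"
    have "ereal (?Q z + p) \<le> ereal (?Q ?w) + \<Psi> ?w"
      using prox_grad_step_le[OF step, of ?w] vals by simp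
    also have "\<dots> \<le> ereal (?Q ?w)
        + ereal ((1 - t) * p + t * q - c / 2 * (t * (1 - t) * (norm (u - z))\<^sup>2))"
      using convex_ext_strongD[OF conv vals, of t] t by (intro add_left_mono) simp
    finally have "t * (?Q z + p + (1 - t) * ?D) \<le> t * (?Q u + q)"
      unfolding quad_model_convex_combination by (simp add: field_simps)
    with t show ?thesis by simp
  qed
  have "((\<lambda>t. ?Q z + p + (1 - t) * ?D) \<longlongrightarrow> ?Q z + p + (1 - 0) * ?D) (at_right 0)"
    by (intro tendsto_intros)
  moreover have "\<forall>\<^sub>F t in at_right (0::real). ?Q z + p + (1 - t) * ?D \<le> ?Q u + q"
    using growth by (auto simp: eventually_at_right_field intro!: exI[of _ 1])
  ultimately show ?thesis
    using tendsto_upperbound[of "\<lambda>t. ?Q z + p + (1 - t) * ?D"] by fastforce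
qed

text \<open>
  The model \<open>Q\<close> replaces the curvature \<open>\<mu>f\<close> guaranteed for \<open>f\<close> by \<open>l\<close>, so passing from \<open>F u\<close> to the
  model at \<open>u\<close> costs \<open>(l - \<mu>f) / 2 * |u - y|\<^sup>2\<close>; the growth of the model away from \<open>z\<close> and the
  descent condition do the rest.
\<close>

lemma prox_grad_lower_bound:
  fixes \<Psi> :: "'a::real_inner \<Rightarrow> ereal"
  assumes f_strong: "convex_on UNIV (\<lambda>p. f p - \<mu>f / 2 * (norm p)\<^sup>2)"
    and grad: "GDERIV f y :> gradf y"
    and \<Psi>_strong: "convex_ext (\<lambda>p. \<Psi> p - ereal (\<mu>\<Psi> / 2 * (norm p)\<^sup>2))"
    and \<Psi>_not_MInf: "\<And>p. \<Psi> p \<noteq> -\<infinity>"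
    and step: "z \<in> prox_grad_step f gradf \<Psi> l y"
    and descent: "F' \<le> ereal (quad_model f gradf l y z) + \<Psi> z"
  shows "F' + ereal ((l + \<mu>\<Psi>) / 2 * (norm (u - z))\<^sup>2 - (l - \<mu>f) / 2 * (norm (u - y))\<^sup>2)
    \<le> objective f \<Psi> u"
proof (cases "\<Psi> u")
  case (real q)
  then have "\<Psi> z \<noteq> \<infinity>" using prox_grad_step_finite[OF step, of u] by simp
  then obtain p where p: "\<Psi> z = ereal p" using \<Psi>_not_MInf[of z] by (cases "\<Psi> z") auto
  have "quad_model f gradf l y u - (l - \<mu>f) / 2 * (norm (u - y))\<^sup>2 \<le> f u"
    using strongly_convex_above_tangent[OF f_strong grad, of u]
    by (simp add: quad_model_def field_simps)
  with prox_grad_step_growth[OF \<Psi>_strong step p real]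
  have "quad_model f gradf l y z + p
      + ((l + \<mu>\<Psi>) / 2 * (norm (u - z))\<^sup>2 - (l - \<mu>f) / 2 * (norm (u - y))\<^sup>2) \<le> f u + q"
    by linarith
  with descent show ?thesis
    by (cases F') (auto simp: p real objective_def)
qed (use \<Psi>_not_MInf[of u] in \<open>auto simp: objective_def\<close>)

section \<open>The weight bound and the estimate centre\<close>

text \<open>The bound is the larger root in \<open>a\<close> of the quadratic equation behind the conclusion.\<close>

lemma weight_bound_quadratic:
  assumes bound: "a \<le> weight_bound \<mu>f \<mu> \<gamma> A l"
    and "0 \<le> a" "\<mu>f < l" "0 \<le> A" "0 < \<gamma>" "0 \<le> \<mu>"
  shows "a\<^sup>2 * (l - \<mu>f) \<le> A * \<gamma> + a * (\<gamma> + A * \<mu>)"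
proof -
  define d where "d = l - \<mu>f"
  define b where "b = \<gamma> + A * \<mu>"
  have pos: "0 < d" "0 < b" "0 \<le> A * \<gamma>"
    using assms by (auto simp: d_def b_def add_pos_nonneg)
  define R where "R = sqrt (1 + 4 * d * A * \<gamma> / b\<^sup>2)"
  have R_sq: "(b * R)\<^sup>2 = b\<^sup>2 + 4 * d * (A * \<gamma>)"
  proof -
    have "0 \<le> 4 * d * A * \<gamma> / b\<^sup>2" using pos assms by simp
    then show ?thesis using pos by (simp add: R_def power_mult_distrib field_simps)
  qed
  have "a \<le> b / (2 * d) * (1 + R)"
    using bound by (simp add: weight_bound_def R_def b_def d_def)
  then have root: "2 * d * a - b \<le> b * R"
    using pos by (simp add: field_simps)
  have "a\<^sup>2 * d \<le> A * \<gamma> + a * b"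
  proof (cases "2 * d * a \<le> b")
    case True
    then have "a * (2 * d * a) \<le> a * b" using \<open>0 \<le> a\<close> by (rule mult_left_mono)
    moreover have "0 \<le> a * b" using pos \<open>0 \<le> a\<close> by simp
    ultimately show ?thesis using pos by (simp add: power2_eq_square algebra_simps)
  next
    case False
    then have "(2 * d * a - b)\<^sup>2 \<le> (b * R)\<^sup>2" using root by (intro power_mono) auto
    then have "4 * d * (a\<^sup>2 * d) \<le> 4 * d * (A * \<gamma> + a * b)"
      unfolding R_sq by (simp add: power2_eq_square algebra_simps)
    then show ?thesis using pos by simp
  qed
  then show ?thesis by (simp add: d_def b_def)
qed

text \<open>
  With all points measured from \<open>y\<close>, the right side exceeds the left by \<open>1 / (2 * \<gamma>')\<close> times
  \<open>(m - l) * (A * \<gamma>' * |x|\<^sup>2 + a * \<gamma> * |v|\<^sup>2) + m * ((A + a) * \<gamma>' - a\<^sup>2 * m) * |z|\<^sup>2\<close>. The point \<open>s\<close>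
  drops out because \<open>v'\<close> is the weighted mean of \<open>v\<close>, \<open>z\<close> and \<open>y\<close> with weights \<open>\<gamma>\<close>, \<open>a * m\<close> and
  \<open>- a * l\<close>, and the mixed products drop out because \<open>y\<close> is the mean of \<open>x\<close> and \<open>v\<close> with weights
  \<open>A * \<gamma>'\<close> and \<open>a * \<gamma>\<close>.
\<close>

lemma estimate_centre_descent:
  fixes x y z v v' s :: "'a::real_inner"
  assumes \<gamma>': "\<gamma>' = \<gamma> + a * (m - l)" "0 < \<gamma>'"
    and v': "\<gamma>' *\<^sub>R v' = \<gamma> *\<^sub>R v + (a * m) *\<^sub>R z - (a * l) *\<^sub>R y"
    and y: "(A * \<gamma>' + a * \<gamma>) *\<^sub>R y = (A * \<gamma>') *\<^sub>R x + (a * \<gamma>) *\<^sub>R v"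
    and nonneg: "0 \<le> A" "0 \<le> a" "0 \<le> \<gamma>" "0 \<le> m" "l \<le> m"
    and weight: "a\<^sup>2 * m \<le> (A + a) * \<gamma>'"
  shows "\<gamma>' / 2 * (norm (v' - s))\<^sup>2
      + A * (l / 2 * (norm (x - y))\<^sup>2 - m / 2 * (norm (x - z))\<^sup>2)
      + a * (l / 2 * (norm (s - y))\<^sup>2 - m / 2 * (norm (s - z))\<^sup>2)
    \<le> \<gamma> / 2 * (norm (v - s))\<^sup>2"
proof -
  define p q w e where "p = x - y" and "q = v - y" and "w = z - y" and "e = s - y"
  have centre: "\<gamma>' *\<^sub>R (v' - s) = \<gamma> *\<^sub>R q + (a * m) *\<^sub>R w - \<gamma>' *\<^sub>R e"
    using v' by (simp add: p_def q_def w_def e_def \<gamma>'(1) algebra_simps)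
  have mean: "(A * \<gamma>') *\<^sub>R p = - ((a * \<gamma>) *\<^sub>R q)"
    using y by (simp add: p_def q_def algebra_simps)
  have mixed: "A * \<gamma>' * (p \<bullet> w) = - (a * \<gamma> * (q \<bullet> w))"
    using arg_cong[OF mean, of "\<lambda>r. r \<bullet> w"] by (simp only: inner_scaleR_left inner_minus_left)
  have diffs: "x - z = p - w" "s - z = e - w" "v - s = q - e" "x - y = p" "s - y = e"
    by (simp_all add: p_def q_def w_def e_def)
  have "(\<gamma>')\<^sup>2 * (norm (v' - s))\<^sup>2 = (norm (\<gamma>' *\<^sub>R (v' - s)))\<^sup>2"
    by (simp add: power_mult_distrib)
  also have "\<dots> = \<gamma>\<^sup>2 * (q \<bullet> q) + (a * m)\<^sup>2 * (w \<bullet> w) + (\<gamma>')\<^sup>2 * (e \<bullet> e)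
      + 2 * (\<gamma> * (a * m)) * (q \<bullet> w) - 2 * (\<gamma> * \<gamma>') * (q \<bullet> e) - 2 * (a * m * \<gamma>') * (e \<bullet> w)"
    unfolding centre power2_norm_eq_inner
    by (simp add: inner_simps inner_commute power2_eq_square algebra_simps)
  finally have moved: "(\<gamma>')\<^sup>2 * (norm (v' - s))\<^sup>2 = \<dots>" .
  have "2 * \<gamma>' * (\<gamma> / 2 * (norm (v - s))\<^sup>2 - (\<gamma>' / 2 * (norm (v' - s))\<^sup>2
      + A * (l / 2 * (norm (x - y))\<^sup>2 - m / 2 * (norm (x - z))\<^sup>2)
      + a * (l / 2 * (norm (s - y))\<^sup>2 - m / 2 * (norm (s - z))\<^sup>2)))
    = \<gamma> * \<gamma>' * (norm (q - e))\<^sup>2 - (\<gamma>')\<^sup>2 * (norm (v' - s))\<^sup>2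
      - A * \<gamma>' * (l * (p \<bullet> p) - m * (norm (p - w))\<^sup>2)
      - a * \<gamma>' * (l * (e \<bullet> e) - m * (norm (e - w))\<^sup>2)"
    unfolding diffs power2_norm_eq_inner[of p] power2_norm_eq_inner[of e]
    by (simp add: power2_eq_square algebra_simps)
  also have "\<dots> = (m - l) * (A * \<gamma>' * (p \<bullet> p) + a * \<gamma> * (q \<bullet> q))
      + m * ((A + a) * \<gamma>' - a\<^sup>2 * m) * (w \<bullet> w)
      - 2 * m * (A * \<gamma>' * (p \<bullet> w) + a * \<gamma> * (q \<bullet> w))"
    unfolding moved unfolding power2_norm_eq_inner \<gamma>'(1)
    by (simp add: inner_simps inner_commute power2_eq_square algebra_simps)
  also have "\<dots> \<ge> 0"
    using nonneg weight \<gamma>'(2) by (simp add: mixed)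
  finally have "0 \<le> 2 * \<gamma>' * (\<gamma> / 2 * (norm (v - s))\<^sup>2 - (\<gamma>' / 2 * (norm (v' - s))\<^sup>2
      + A * (l / 2 * (norm (x - y))\<^sup>2 - m / 2 * (norm (x - z))\<^sup>2)
      + a * (l / 2 * (norm (s - y))\<^sup>2 - m / 2 * (norm (s - z))\<^sup>2)))" .
  with \<gamma>'(2) show ?thesis by (simp add: zero_le_mult_iff)
qed

section \<open>Monotonicity of the gap sequence\<close>

theorem proposition2p5:
  fixes f :: "real ^ 'n \<Rightarrow> real" and gradf :: "real ^ 'n \<Rightarrow> real ^ 'n"
    and \<Psi> F :: "real ^ 'n \<Rightarrow> ereal"
    and \<mu>f \<mu>\<Psi> \<mu> :: real
    and xstar :: "real ^ 'n"
    and A a \<gamma> L Y :: "nat \<Rightarrow> real"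
    and x y z v :: "nat \<Rightarrow> real ^ 'n"
  assumes f_convex: "convex_on UNIV f"
    and f_grad: "\<And>p. GDERIV f p :> gradf p"
    and f_grad_lipschitz: "\<exists>M. M-lipschitz_on UNIV gradf"
    and \<mu>f_nonneg: "\<mu>f \<ge> 0"
    and f_strong: "convex_on UNIV (\<lambda>p. f p - \<mu>f / 2 * (norm p)\<^sup>2)"
    and \<Psi>_not_MInf: "\<And>p. \<Psi> p \<noteq> -\<infinity>"
    and \<Psi>_convex: "convex_ext \<Psi>"
    and \<Psi>_lsc: "lower_semicontinuous \<Psi>"
    and \<Psi>_proper: "\<exists>p. \<Psi> p \<noteq> \<infinity>"
    and \<mu>\<Psi>_nonneg: "\<mu>\<Psi> \<ge> 0"
    and \<Psi>_strong: "convex_ext (\<lambda>p. \<Psi> p - ereal (\<mu>\<Psi> / 2 * (norm p)\<^sup>2))"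
    and F_eq: "F = objective f \<Psi>"
    and \<mu>_eq: "\<mu> = \<mu>f + \<mu>\<Psi>"
    and xstar_min: "is_arg_min F (\<lambda>_. True) xstar"
    and A0: "A 0 \<ge> 0"
    and \<gamma>0: "\<gamma> 0 > 0"
    and v0: "v 0 = x 0"
    and x0_finite: "A 0 > 0 \<Longrightarrow> F (x 0) < \<infinity>"
    and a_pos: "\<And>k. a (Suc k) > 0"
    and L_pos: "\<And>k. L (Suc k) > 0"
    and L_gt: "\<And>k. L (Suc k) > \<mu>f"
    and z_step: "\<And>k. z (Suc k) \<in> prox_grad_step f gradf \<Psi> (L (Suc k)) (y (Suc k))"
    and A_step: "\<And>k. A (Suc k) = A k + a (Suc k)"
    and \<gamma>_step: "\<And>k. \<gamma> (Suc k) = \<gamma> k + a (Suc k) * \<mu>"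
    and v_step: "\<And>k. v (Suc k) = (1 / \<gamma> (Suc k)) *\<^sub>R
          (\<gamma> k *\<^sub>R v k + (a (Suc k) * (L (Suc k) + \<mu>\<Psi>)) *\<^sub>R z (Suc k)
            - (a (Suc k) * (L (Suc k) - \<mu>f)) *\<^sub>R y (Suc k))"
    and monotone: "\<And>k. F (x (Suc k)) \<le> F (z (Suc k))"
    and descent: "\<And>k. F (z (Suc k)) \<le>
          ereal (quad_model f gradf (L (Suc k)) (y (Suc k)) (z (Suc k))) + \<Psi> (z (Suc k))"
    and Y_eq: "\<And>k. Y (Suc k) = A k * \<gamma> (Suc k) + a (Suc k) * \<gamma> k"
    and y_step: "\<And>k. y (Suc k) = (1 / Y (Suc k)) *\<^sub>R
          ((A k * \<gamma> (Suc k)) *\<^sub>R x k + (a (Suc k) * \<gamma> k) *\<^sub>R v k)"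
    and a_bound: "\<And>k. a (Suc k) \<le> weight_bound \<mu>f \<mu> (\<gamma> k) (A k) (L (Suc k))"
  shows "\<forall>k. gap F xstar A \<gamma> x v (Suc k) \<le> gap F xstar A \<gamma> x v k"
proof
  fix k
  have \<mu>_nonneg: "0 \<le> \<mu>" using \<mu>f_nonneg \<mu>\<Psi>_nonneg \<mu>_eq by simp
  have A_nonneg: "0 \<le> A i" for i
    using A0 A_step a_pos by (induction i) (auto simp: less_imp_le)
  have \<gamma>_pos: "0 < \<gamma> i" for i
    using \<gamma>0 \<gamma>_step a_pos \<mu>_nonneg by (induction i) (auto simp: add_pos_nonneg less_imp_le)

  have F_not_MInf: "F u \<noteq> -\<infinity>" for u
    using \<Psi>_not_MInf[of u] by (cases "\<Psi> u") (auto simp: F_eq objective_def)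
  have F_Suc: "F (x (Suc i)) < \<infinity>" for i
  proof -
    obtain u where "\<Psi> u \<noteq> \<infinity>" using \<Psi>_proper by blast
    then have "\<Psi> (z (Suc i)) \<noteq> \<infinity>" using z_step prox_grad_step_finite by blast
    then have "F (z (Suc i)) < \<infinity>" by (simp add: F_eq objective_def)
    with monotone show ?thesis by (rule le_less_trans)
  qed
  obtain Fs where Fs: "F xstar = ereal Fs"
  proof -
    have "F xstar \<le> F (x (Suc k))" using xstar_min by (auto simp: is_arg_min_def not_less)
    with F_Suc[of k] F_not_MInf[of xstar] that show ?thesis by (cases "F xstar") auto
  qed
  obtain Fn where Fn: "F (x (Suc k)) = ereal Fn"
    using F_Suc[of k] F_not_MInf[of "x (Suc k)"] by (cases "F (x (Suc k))") auto
  have F_cur: "F (x k) < \<infinity>" if "0 < A k"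
    using that x0_finite F_Suc by (cases k) auto

  define \<alpha> where "\<alpha> = a (Suc k)"
  define m where "m = L (Suc k) + \<mu>\<Psi>"
  define l where "l = L (Suc k) - \<mu>f"
  define B where "B u = m / 2 * (norm (u - z (Suc k)))\<^sup>2 - l / 2 * (norm (u - y (Suc k)))\<^sup>2" for u
  have \<mu>_ml: "\<mu> = m - l" by (simp add: \<mu>_eq m_def l_def)
  have pos: "0 < \<alpha>" "0 < l" "0 < m"
    using a_pos L_gt L_pos \<mu>\<Psi>_nonneg by (auto simp: \<alpha>_def l_def m_def add_pos_nonneg)
  have lower: "ereal (Fn + B u) \<le> F u" for u
    using prox_grad_lower_bound[OF f_strong f_grad \<Psi>_strong \<Psi>_not_MInf z_step
        order.trans[OF monotone descent], of k u]
    by (simp add: Fn B_def m_def l_def flip: F_eq)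

  have distances: "\<gamma> (Suc k) / 2 * (norm (v (Suc k) - xstar))\<^sup>2 - A k * B (x k) - \<alpha> * B xstar
      \<le> \<gamma> k / 2 * (norm (v k - xstar))\<^sup>2"
  proof -
    have Y_pos: "0 < Y (Suc k)"
      using A_nonneg[of k] \<gamma>_pos[of k] \<gamma>_pos[of "Suc k"] a_pos[of k]
      by (simp add: Y_eq add_nonneg_pos)
    have "\<alpha>\<^sup>2 * l \<le> A k * \<gamma> k + \<alpha> * (\<gamma> k + A k * \<mu>)"
      unfolding \<alpha>_def l_def
      using weight_bound_quadratic[OF a_bound] a_pos L_gt A_nonneg \<gamma>_pos \<mu>_nonneg
      by (simp add: less_imp_le)
    then have weight: "\<alpha>\<^sup>2 * m \<le> (A k + \<alpha>) * \<gamma> (Suc k)"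
      by (simp add: \<gamma>_step \<mu>_ml flip: \<alpha>_def) (simp add: power2_eq_square algebra_simps)
    have "\<gamma> (Suc k) / 2 * (norm (v (Suc k) - xstar))\<^sup>2
        + A k * (l / 2 * (norm (x k - y (Suc k)))\<^sup>2 - m / 2 * (norm (x k - z (Suc k)))\<^sup>2)
        + \<alpha> * (l / 2 * (norm (xstar - y (Suc k)))\<^sup>2 - m / 2 * (norm (xstar - z (Suc k)))\<^sup>2)
      \<le> \<gamma> k / 2 * (norm (v k - xstar))\<^sup>2"
    proof (rule estimate_centre_descent[OF _ _ _ _ _ _ _ _ _ weight])
      show "\<gamma> (Suc k) = \<gamma> k + \<alpha> * (m - l)" by (simp add: \<gamma>_step \<mu>_ml \<alpha>_def)
      show "\<gamma> (Suc k) *\<^sub>R v (Suc k) = \<gamma> k *\<^sub>R v k + (\<alpha> * m) *\<^sub>R z (Suc k) - (\<alpha> * l) *\<^sub>R y (Suc k)"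
        using \<gamma>_pos[of "Suc k"] by (simp add: v_step \<alpha>_def m_def l_def)
      show "(A k * \<gamma> (Suc k) + \<alpha> * \<gamma> k) *\<^sub>R y (Suc k)
          = (A k * \<gamma> (Suc k)) *\<^sub>R x k + (\<alpha> * \<gamma> k) *\<^sub>R v k"
        using Y_pos unfolding y_step \<alpha>_def Y_eq by simp
    qed (use pos A_nonneg \<gamma>_pos \<mu>_nonneg \<mu>_ml in \<open>auto simp: less_imp_le\<close>)
    then show ?thesis by (simp add: B_def algebra_simps)
  qed
  have at_min: "\<alpha> * (Fn + B xstar) \<le> \<alpha> * Fs"
    using lower[of xstar] pos by (simp add: Fs)

  (* If A k = 0, the value of F at x k may be infinite; any real number can then stand for it. *)
  obtain Fc where Fc: "ereal (A k) * (F (x k) - F xstar) = ereal (A k * (Fc - Fs))"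
    and at_cur: "A k * (Fn + B (x k)) \<le> A k * Fc"
  proof (cases "A k = 0")
    case True
    then show ?thesis using that[of 0] by (simp add: zero_ereal_def[symmetric])
  next
    case False
    then have "0 < A k" using A_nonneg[of k] by simp
    with F_cur F_not_MInf[of "x k"] obtain c where c: "F (x k) = ereal c"
      by (cases "F (x k)") auto
    then show ?thesis
      using that[of c] lower[of "x k"] \<open>0 < A k\<close> by (simp add: Fs)
  qed
  have "A (Suc k) * (Fn - Fs) + \<gamma> (Suc k) / 2 * (norm (v (Suc k) - xstar))\<^sup>2
      \<le> A k * (Fc - Fs) + \<gamma> k / 2 * (norm (v k - xstar))\<^sup>2"
    using distances at_min at_cur by (simp add: A_step \<alpha>_def algebra_simps)
  then show "gap F xstar A \<gamma> x v (Suc k) \<le> gap F xstar A \<gamma> x v k"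
    unfolding gap_def Fc by (simp add: Fs Fn)
qed

end
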